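(* Let $\mu\in(1,\infty)$ and let $\mathbf p(t)=(p_0(t),p_1(t),\ldots)$ be a solution of the system of ODEs $$p_0'=-(\mu-1+p_0)\,p_0,\qquad p_n'=n\,p_{n+1}+(\mu-1+p_0)\,p_{n-1}-(n-1)\,p_n-(\mu-1+p_0)\,p_n\quad(n\ge1),$$ with $\mathbf p(0)\in\mathcal S_\mu$. If $p_0(0)=0$, then for all $t\ge0$ $$\|\mathbf p(t)-\overline{\mathbf p}\|_{\mathcal H}^2\le\|\mathbf p(0)-\overline{\mathbf p}\|_{\mathcal H}^2\,e^{-2t}.$$
   Context: $\mathbb N=\{0,1,2,\ldots\}$. For $\mu>0$, $\mathcal S_\mu=\{\mathbf p=(p_n)_{n\ge0} \mid p_n\ge 0,\ \sum_{n\ge0}p_n=1,\ \sum_{n\ge0} n\,p_n=\mu\}$. Total mass and mean are conserved by the system, and the solution $\mathbf p(t)$ with $\mathbf p(0)\in\mathcal S_\mu$ is understood to lie in $\mathcal S_\mu$ for all $t\ge0$. For $\mu>1$ the modified Poisson distribution $\overline{\mathbf p}=(\overline p_n)_{n\ge0}$ is $$\overline p_0=0,\qquad \overline p_n=\frac{(\mu-1)^{n-1}}{(n-1)!}\,e^{-(\mu-1)}\quad(n\ge1).$$ $\mathcal H=\{\mathbf p\in\ell^2(\mathbb N)\mid p_0^2+\sum_{n\ge1}p_n^2/\overline p_n<+\infty\}$ with scalar product $\langle\mathbf p,\mathbf q\rangle_{\mathcal H}=p_0q_0+\sum_{n\ge1}\frac{p_nq_n}{\overline p_n}$ and induced norm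 $\|\cdot\|_{\mathcal H}$. *)

theory Defs
  imports Complex_Main "HOL-Library.Extended_Nonnegative_Real"
begin

definition prob_mean :: "real \<Rightarrow> (nat \<Rightarrow> real) set" where
  "prob_mean \<mu> = {p. (\<forall>n. 0 \<le> p n) \<and> p sums 1 \<and> (\<lambda>n. real n * p n) sums \<mu>}"

definition modified_poisson :: "real \<Rightarrow> nat \<Rightarrow> real" where
  "modified_poisson \<mu> n =
     (if n = 0 then 0 else (\<mu> - 1) ^ (n - 1) / fact (n - 1) * exp (- (\<mu> - 1)))"

definition H_space :: "real \<Rightarrow> (nat \<Rightarrow> real) set" where
  "H_space \<mu> = {p. summable (\<lambda>n. (p n)\<^sup>2) \<and>
                     summable (\<lambda>n. (p (Suc n))\<^sup>2 / modified_poisson \<mu> (Suc n))}"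

definition H_inner :: "real \<Rightarrow> (nat \<Rightarrow> real) \<Rightarrow> (nat \<Rightarrow> real) \<Rightarrow> real" where
  "H_inner \<mu> p q =
     p 0 * q 0 + (\<Sum>n. p (Suc n) * q (Suc n) / modified_poisson \<mu> (Suc n))"

text \<open>The norm takes the value infinity outside the Hilbert space: a sequence with
  a divergent defining sum must not get a finite norm from the totality of suminf.\<close>

definition H_norm :: "real \<Rightarrow> (nat \<Rightarrow> real) \<Rightarrow> ennreal" where
  "H_norm \<mu> p = (if p \<in> H_space \<mu> then ennreal (sqrt (H_inner \<mu> p p)) else \<infinity>)"

text \<open>A solution on the half-line is a componentwise differentiable curve; the derivative
  at time 0 is one-sided. The first argument of p is time, the second the index.\<close>

definition solves_system :: "real \<Rightarrow> (real \<Rightarrow> nat \<Rightarrow> real) \<Rightarrow> bool" where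
  "solves_system \<mu> p \<longleftrightarrow>
     (\<forall>t\<ge>0.
        ((\<lambda>s. p s 0) has_real_derivative - (\<mu> - 1 + p t 0) * p t 0) (at t within {0..}) \<and>
        (\<forall>n\<ge>1. ((\<lambda>s. p s n) has_real_derivative
             real n * p t (n + 1) + (\<mu> - 1 + p t 0) * p t (n - 1)
             - (real n - 1) * p t n - (\<mu> - 1 + p t 0) * p t n) (at t within {0..})))"

end

theory Submission
  imports Defs "HOL-Analysis.Analysis"
begin

text \<open>If \<open>p\<^sub>0(0) = 0\<close> then \<open>p\<^sub>0 = 0\<close>, and \<open>u\<^sub>m = p\<^sub>m\<^sub>+\<^sub>1 - w\<^sub>m\<close> solves the linear forward equation
  of the M/M/infinity queue, whose reversible law is the Poisson distribution \<open>w\<close> with mean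
  \<open>l = \<mu> - 1\<close>. Since nothing is known a priori about the norm of \<open>p(t)\<close>, the energy estimate is made
  on the dual side: the backward semigroup of the chain reflected at \<open>N\<close> is finite-dimensional,
  bounded by its initial data, and by a Poincare inequality with constant independent of \<open>N\<close> it
  contracts the weighted \<open>L\<^sup>2\<close> norm modulo constants at rate 1. Pairing \<open>u\<close> with it costs the integral over time
  of the flux of \<open>p\<close> through the edge from \<open>N\<close> to \<open>N + 1\<close>; these integrals are summable in \<open>N\<close> because the mean of
  \<open>p\<close> is bounded, so the cost vanishes as \<open>N\<close> grows. Testing against truncations of \<open>u(t) / w\<close> gives
  the bound.\<close>

section \<open>Poisson weights, reflected generator and forward rate\<close>

definition poisson_weight :: "real \<Rightarrow> nat \<Rightarrow> real" where
  "poisson_weight l n = l ^ n / fact n * exp (- l)"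

text \<open>\<open>min (Suc m) N\<close> cancels the upward jump at \<open>N\<close>, and
  \<open>m - 1\<close> at \<open>m = 0\<close> is harmless because its rate is 0. Above
  \<open>N\<close> the rates are capped to keep the operator bounded; states up to \<open>N\<close>
  never look there.\<close>

definition truncated_generator :: "real \<Rightarrow> nat \<Rightarrow> (nat \<Rightarrow> real) \<Rightarrow> nat \<Rightarrow> real" where
  "truncated_generator l N g m =
     l * (g (min (Suc m) N) - g m) - real (min m N) * (g m - g (m - 1))"

text \<open>The argument \<open>d\<close> keeps the index of the original system, where \<open>d 0\<close> is the empty state: the rate
  at \<open>m\<close> is the time derivative of \<open>d (Suc m)\<close>.\<close>

definition forward_rate :: "real \<Rightarrow> (nat \<Rightarrow> real) \<Rightarrow> nat \<Rightarrow> real" where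
  "forward_rate l d m =
     real (Suc m) * d (Suc (Suc m)) + l * d m - real m * d (Suc m) - l * d (Suc m)"

lemma poisson_weight_pos: "0 < l \<Longrightarrow> 0 < poisson_weight l n"
  by (simp add: poisson_weight_def)

text \<open>Detailed balance between arrivals at rate \<open>l\<close> and departures at rate
  \<open>Suc n\<close>.\<close>

lemma poisson_weight_Suc:
  "real (Suc n) * poisson_weight l (Suc n) = l * poisson_weight l n"
  by (simp add: poisson_weight_def divide_simps del: of_nat_Suc)

lemma poisson_weight_sums: "poisson_weight l sums 1"
proof -
  have "(\<lambda>n. l ^ n /\<^sub>R fact n * exp (- l)) sums (exp l * exp (- l))"
    by (intro sums_mult2 exp_converges)
  moreover have "(\<lambda>n. l ^ n /\<^sub>R fact n * exp (- l)) = poisson_weight l"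
    by (simp add: fun_eq_iff poisson_weight_def divide_inverse mult.commute)
  ultimately show ?thesis by (simp add: exp_minus)
qed

lemma poisson_weight_le_1:
  assumes "0 < l"
  shows "poisson_weight l n \<le> 1"
proof -
  have "sum (poisson_weight l) {n} \<le> suminf (poisson_weight l)"
    using poisson_weight_sums sums_summable poisson_weight_pos[OF assms]
    by (intro sum_le_suminf) (auto intro: less_imp_le)
  then show ?thesis
    using sums_unique[OF poisson_weight_sums[of l]] by simp
qed

section \<open>Backward semigroup of the reflected chain\<close>

text \<open>Uniformization: adding the constant \<open>C\<close> turns the generator into an operator \<open>K\<close> with nonnegative
  entries and row sums \<open>C\<close>, so that \<open>exp (- C t) exp (t K)\<close> is visibly a contraction for the sup norm.\<close>

lemma truncated_generator_semigroup:
  fixes g0 :: "nat \<Rightarrow> real"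
  assumes l: "0 \<le> l" and bound: "\<And>m. \<bar>g0 m\<bar> \<le> B"
  obtains g :: "real \<Rightarrow> nat \<Rightarrow> real"
  where "g 0 = g0"
    and "\<And>t m. ((\<lambda>s. g s m) has_real_derivative truncated_generator l N (g t) m) (at t)"
    and "\<And>t m. 0 \<le> t \<Longrightarrow> \<bar>g t m\<bar> \<le> B"
proof -
  define C where "C = l + real N"
  define K where "K g m = truncated_generator l N g m + C * g m" for g :: "nat \<Rightarrow> real" and m
  define c where "c k = (K ^^ k) g0" for k
  have C0: "0 \<le> C" using l by (simp add: C_def)
  have K_eq: "K g m = l * g (min (Suc m) N) + real (N - min m N) * g m + real (min m N) * g (m - 1)"
    for g m by (simp add: K_def truncated_generator_def C_def of_nat_diff algebra_simps)
  have K_bound: "\<bar>K g m\<bar> \<le> C * b" if b: "\<And>j. \<bar>g j\<bar> \<le> b" for g m b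
  proof -
    have "\<bar>K g m\<bar> \<le> l * \<bar>g (min (Suc m) N)\<bar> + real (N - min m N) * \<bar>g m\<bar>
        + real (min m N) * \<bar>g (m - 1)\<bar>"
    proof -
      have "\<bar>x + y + z\<bar> \<le> \<bar>x\<bar> + \<bar>y\<bar> + \<bar>z\<bar>" for x y z :: real by linarith
      from this[of "l * g (min (Suc m) N)" "real (N - min m N) * g m" "real (min m N) * g (m - 1)"]
      show ?thesis unfolding K_eq using l by (simp only: abs_mult abs_of_nonneg of_nat_0_le_iff)
    qed
    also have "\<dots> \<le> l * b + real (N - min m N) * b + real (min m N) * b"
      using l b by (intro add_mono mult_left_mono) auto
    also have "\<dots> = C * b" by (simp add: C_def of_nat_diff algebra_simps)
    finally show ?thesis .
  qed
  have c_bound: "\<bar>c k m\<bar> \<le> C ^ k * B" for k m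
  proof (induction k arbitrary: m)
    case 0 then show ?case using bound by (simp add: c_def)
  next
    case (Suc k)
    have "\<bar>K (c k) m\<bar> \<le> C * (C ^ k * B)" by (rule K_bound) (rule Suc)
    then show ?case by (simp add: c_def mult.assoc)
  qed
  \<comment> \<open>Taylor coefficients in \<open>t\<close> of \<open>exp (t K) g0\<close> at
    \<open>m\<close>; \<open>c_bound\<close> makes the series converge for every
    \<open>t\<close>.\<close>
  define a where "a m k = c k m / fact k" for m k
  have exp_sums: "(\<lambda>k. B * ((C * \<bar>t\<bar>) ^ k /\<^sub>R fact k)) sums (B * exp (C * \<bar>t\<bar>))" for t
    by (intro sums_mult exp_converges)
  have a_bound: "norm (a m k * t ^ k) \<le> B * ((C * \<bar>t\<bar>) ^ k /\<^sub>R fact k)" for m k t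
  proof -
    have "norm (a m k * t ^ k) = \<bar>c k m\<bar> * (\<bar>t\<bar> ^ k / fact k)"
      by (simp add: a_def abs_mult power_abs)
    also have "\<dots> \<le> (C ^ k * B) * (\<bar>t\<bar> ^ k / fact k)"
      by (intro mult_right_mono c_bound) simp
    finally show ?thesis by (simp add: power_mult_distrib divide_inverse mult_ac)
  qed
  have a_summable: "summable (\<lambda>k. a m k * t ^ k)" for m t
    by (rule summable_comparison_test'[OF sums_summable[OF exp_sums]]) (rule a_bound)
  define G where "G t m = (\<Sum>k. a m k * t ^ k)" for t m
  have G_bound: "\<bar>G t m\<bar> \<le> B * exp (C * \<bar>t\<bar>)" for t m
  proof -
    have "norm (\<Sum>k. a m k * t ^ k) \<le> (\<Sum>k. B * ((C * \<bar>t\<bar>) ^ k /\<^sub>R fact k))"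
      by (rule norm_suminf_le[OF a_bound sums_summable[OF exp_sums]])
    then show ?thesis using exp_sums[of t] by (simp add: G_def sums_iff)
  qed
  have G_deriv: "((\<lambda>s. G s m) has_real_derivative K (G t) m) (at t)" for t m
  proof -
    have deriv: "((\<lambda>s. G s m) has_real_derivative (\<Sum>k. diffs (a m) k * t ^ k)) (at t)"
      unfolding G_def by (rule termdiffs_strong_converges_everywhere) (rule a_summable)
    \<comment> \<open>Differentiation shifts \<open>c k\<close> to
      \<open>c (Suc k) = K (c k)\<close>.\<close>
    have diffs_a: "diffs (a m) k = l * a (min (Suc m) N) k + real (N - min m N) * a m k
        + real (min m N) * a (m - 1) k" for k
    proof -
      have "diffs (a m) k = c (Suc k) m / fact k"
        by (simp add: diffs_def a_def divide_simps del: of_nat_Suc)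
      then show ?thesis by (simp add: c_def K_eq a_def add_divide_distrib)
    qed
    have "(\<Sum>k. diffs (a m) k * t ^ k) =
        (\<Sum>k. l * (a (min (Suc m) N) k * t ^ k) + real (N - min m N) * (a m k * t ^ k)
          + real (min m N) * (a (m - 1) k * t ^ k))"
      by (simp only: diffs_a distrib_right mult.assoc)
    also have "\<dots> = K (G t) m"
      unfolding K_eq G_def
      by (intro sums_unique[symmetric] sums_add sums_mult summable_sums a_summable)
    finally show ?thesis using deriv by simp
  qed
  show ?thesis
  proof (rule that[of "\<lambda>t m. exp (- (C * t)) * G t m"])
    show "(\<lambda>m. exp (- (C * 0)) * G 0 m) = g0"
      unfolding G_def powser_zero by (simp add: a_def c_def)
    show "((\<lambda>s. exp (- (C * s)) * G s m) has_real_derivative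
        truncated_generator l N (\<lambda>m. exp (- (C * t)) * G t m) m) (at t)" for t m
      by (rule derivative_eq_intros G_deriv refl)+
        (simp add: K_def truncated_generator_def algebra_simps)
    show "\<bar>exp (- (C * t)) * G t m\<bar> \<le> B" if "0 \<le> t" for t m
    proof -
      have "\<bar>exp (- (C * t)) * G t m\<bar> \<le> exp (- (C * t)) * (B * exp (C * t))"
        using G_bound[of t m] that by (simp add: abs_mult)
      also have "\<dots> = B" by (simp add: exp_minus)
      finally show ?thesis .
    qed
  qed
qed

section \<open>Dirichlet form, Hardy and Poincare inequalities\<close>

text \<open>Summation by parts with detailed balance. Constant \<open>f\<close> gives conservation
  of the mean, and \<open>f = g - c\<close> gives dissipation of energy.\<close>

lemma truncated_generator_dirichlet:
  assumes l: "0 < l"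
  shows "(\<Sum>m\<le>N. poisson_weight l m * f m * truncated_generator l N g m) =
    - l * (\<Sum>m<N. poisson_weight l m * (f (Suc m) - f m) * (g (Suc m) - g m))"
proof -
  let ?w = "poisson_weight l"
  \<comment> \<open>The boundary term is what the generator reflected at \<open>n\<close>
    contributes at its last site.\<close>
  have "(\<Sum>m<n. ?w m * f m * (l * (g (Suc m) - g m) - real m * (g m - g (m - 1))))
      - real n * ?w n * f n * (g n - g (n - 1)) =
      - l * (\<Sum>m<n. ?w m * (f (Suc m) - f m) * (g (Suc m) - g m))" for n
  proof (induction n)
    case (Suc n)
    then show ?case
      unfolding sum.lessThan_Suc poisson_weight_Suc by (simp add: algebra_simps)
  qed simp
  note this[of N]
  moreover have "(\<Sum>m<N. ?w m * f m * truncated_generator l N g m) =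
      (\<Sum>m<N. ?w m * f m * (l * (g (Suc m) - g m) - real m * (g m - g (m - 1))))"
    by (intro sum.cong) (auto simp: truncated_generator_def min_def)
  ultimately show ?thesis
    by (simp add: lessThan_Suc_atMost[symmetric] truncated_generator_def mult_ac)
qed

text \<open>Writing \<open>y k\<close> for the flux divided by \<open>l * poisson_weight l k\<close> is the ground state
  substitution for this Hardy inequality; the cross term is split by AM-GM and the rest telescopes.\<close>

lemma poisson_hardy:
  assumes l: "0 < l"
  shows "l * (\<Sum>k\<le>n. poisson_weight l k * (y k)\<^sup>2)
      + l * (l - real (Suc n)) * poisson_weight l n * (y n)\<^sup>2
    \<le> (\<Sum>k\<le>n. poisson_weight l k * (l * y k - real k * y (k - 1))\<^sup>2)"
proof (induction n)
  case 0
  show ?case by (simp add: power2_eq_square algebra_simps)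
next
  case (Suc n)
  let ?w = "poisson_weight l"
  have step: "l * (l - real (Suc n)) * ?w (Suc n) * (y (Suc n))\<^sup>2
      - l * (l - real (Suc n)) * ?w n * (y n)\<^sup>2
      \<le> ?w (Suc n) * (l * y (Suc n) - real (Suc n) * y n)\<^sup>2"
  proof -
    have "?w (Suc n) * (l * y (Suc n) - real (Suc n) * y n)\<^sup>2 -
        (l * (l - real (Suc n)) * ?w (Suc n) * (y (Suc n))\<^sup>2
          - (l - real (Suc n)) * (l * ?w n) * (y n)\<^sup>2)
      = l * real (Suc n) * ?w (Suc n) * (y (Suc n) - y n)\<^sup>2"
      unfolding poisson_weight_Suc[symmetric] by (simp add: power2_eq_square algebra_simps)
    also have "\<dots> \<ge> 0"
      using l poisson_weight_pos[OF l, of "Suc n"] by simp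
    finally show ?thesis by (simp add: mult_ac)
  qed
  \<comment> \<open>The new summand raises the factor \<open>l - real (Suc (Suc n))\<close> to
    \<open>l - real (Suc n)\<close>, the one in \<open>step\<close>.\<close>
  have "l * (\<Sum>k\<le>Suc n. ?w k * (y k)\<^sup>2)
      + l * (l - real (Suc (Suc n))) * ?w (Suc n) * (y (Suc n))\<^sup>2
    = l * (\<Sum>k\<le>n. ?w k * (y k)\<^sup>2) + l * (l - real (Suc n)) * ?w (Suc n) * (y (Suc n))\<^sup>2"
    by (simp add: algebra_simps)
  with Suc step show ?case by simp
qed

text \<open>A function of mean zero is the divergence of a flux vanishing at \<open>N\<close>.
  Pairing this flux with the gradient of \<open>h\<close> and bounding it by
  \<open>poisson_hardy\<close> yields the constant \<open>l\<close>, hence decay at rate 1.\<close>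

lemma poisson_poincare:
  assumes l: "0 < l" and mean: "(\<Sum>m\<le>N. poisson_weight l m * h m) = 0"
  shows "(\<Sum>m\<le>N. poisson_weight l m * (h m)\<^sup>2)
    \<le> l * (\<Sum>m<N. poisson_weight l m * (h (Suc m) - h m)\<^sup>2)"
proof -
  let ?w = "poisson_weight l"
  define S where "S k = (\<Sum>m\<le>k. ?w m * h m)" for k
  \<comment> \<open>This scaling turns the expression squared in \<open>poisson_hardy\<close> into
    \<open>- h\<close>; mean zero gives \<open>y N = 0\<close>, which removes the boundary
    terms.\<close>
  define y where "y k = - S k / (l * ?w k)" for k
  have w: "0 < ?w k" for k by (rule poisson_weight_pos[OF l])
  have S_y: "S k = - (l * ?w k * y k)" for k
    using l w[of k] by (simp add: y_def)
  have flux: "l * y k - real k * y (k - 1) = - h k" for k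
  proof (cases k)
    case 0
    then show ?thesis using l w[of 0] by (simp add: y_def S_def)
  next
    case (Suc j)
    have "?w k * h k = S k - S j" using Suc by (simp add: S_def)
    also have "\<dots> = - (l * ?w k * y k) + real k * ?w k * y j"
      using Suc by (simp only: S_y poisson_weight_Suc)
    finally have "?w k * (l * y k - real k * y j + h k) = 0" by (simp add: algebra_simps)
    then show ?thesis using w[of k] Suc by simp
  qed
  have yN: "y N = 0" using mean by (simp add: y_def S_def)
  have "(\<Sum>m\<le>n. ?w m * (h m)\<^sup>2) = S n * h n - (\<Sum>m<n. S m * (h (Suc m) - h m))" for n
    by (induction n) (auto simp: S_def power2_eq_square algebra_simps)
  from this[of N] have parts:
    "(\<Sum>m\<le>N. ?w m * (h m)\<^sup>2) = (\<Sum>m<N. l * ?w m * (y m * (h (Suc m) - h m)))"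
    using yN by (simp add: S_y sum_negf[symmetric] mult_ac)
  have hardy: "l * (\<Sum>m<N. ?w m * (y m)\<^sup>2) \<le> (\<Sum>m\<le>N. ?w m * (h m)\<^sup>2)"
  proof -
    have "(\<Sum>m\<le>N. ?w m * (y m)\<^sup>2) = (\<Sum>m<N. ?w m * (y m)\<^sup>2)"
      using yN by (simp add: lessThan_Suc_atMost[symmetric])
    with poisson_hardy[OF l, of y N] yN show ?thesis unfolding flux by simp
  qed
  have "2 * (\<Sum>m<N. l * ?w m * (y m * (h (Suc m) - h m))) =
      (\<Sum>m<N. l * ?w m * (2 * y m * (h (Suc m) - h m)))"
    unfolding sum_distrib_left by (intro sum.cong) auto
  also have "\<dots> \<le> (\<Sum>m<N. l * ?w m * ((y m)\<^sup>2 + (h (Suc m) - h m)\<^sup>2))"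
    using l w by (intro sum_mono mult_left_mono sum_squares_bound) (auto intro: less_imp_le)
  also have "\<dots> = l * (\<Sum>m<N. ?w m * (y m)\<^sup>2) + l * (\<Sum>m<N. ?w m * (h (Suc m) - h m)\<^sup>2)"
    by (simp add: sum.distrib sum_distrib_left algebra_simps)
  finally show ?thesis using parts hardy by linarith
qed

section \<open>Exponential decay of the reflected semigroup\<close>

text \<open>The weighted mean of \<open>g t - c\<close> stays zero, so the Poincare inequality
  applies at every time and makes \<open>exp (2 * t)\<close> times the energy nonincreasing.\<close>

lemma truncated_semigroup_decay:
  fixes g :: "real \<Rightarrow> nat \<Rightarrow> real"
  assumes l: "0 < l"
    and deriv: "\<And>t m. ((\<lambda>s. g s m) has_real_derivative truncated_generator l N (g t) m) (at t)"
    and c: "(\<Sum>m\<le>N. poisson_weight l m * (g 0 m - c)) = 0"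
    and t: "0 \<le> t"
  shows "exp (2 * t) * (\<Sum>m\<le>N. poisson_weight l m * (g t m - c)\<^sup>2)
    \<le> (\<Sum>m\<le>N. poisson_weight l m * (g 0 m - c)\<^sup>2)"
proof -
  let ?w = "poisson_weight l"
  let ?E = "\<lambda>t. \<Sum>m\<le>N. ?w m * (g t m - c)\<^sup>2"
  let ?D = "\<lambda>t. l * (\<Sum>m<N. ?w m * (g t (Suc m) - g t m)\<^sup>2)"
  have "((\<lambda>s. \<Sum>m\<le>N. ?w m * (g s m - c)) has_real_derivative
      (\<Sum>m\<le>N. ?w m * truncated_generator l N (g s) m)) (at s)" for s
    by (auto intro!: derivative_eq_intros deriv sum.cong)
  moreover have "(\<Sum>m\<le>N. ?w m * truncated_generator l N (g s) m) = 0" for s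
    using truncated_generator_dirichlet[OF l, of "\<lambda>_. 1" N "g s"] by simp
  ultimately have "((\<lambda>s. \<Sum>m\<le>N. ?w m * (g s m - c)) has_real_derivative 0) (at s)" for s
    by simp
  then have mean: "(\<Sum>m\<le>N. ?w m * (g s m - c)) = 0" for s
    using DERIV_isconst_all[of "\<lambda>s. \<Sum>m\<le>N. ?w m * (g s m - c)" s 0] c by simp
  have E_deriv: "(?E has_real_derivative - 2 * ?D s) (at s)" for s
  proof -
    have "(?E has_real_derivative
        2 * (\<Sum>m\<le>N. ?w m * (g s m - c) * truncated_generator l N (g s) m)) (at s)"
      by (auto intro!: derivative_eq_intros deriv sum.cong simp: sum_distrib_left mult_ac)
    then show ?thesis
      using truncated_generator_dirichlet[OF l, of "\<lambda>m. g s m - c" N "g s"]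
      by (simp add: power2_eq_square mult.assoc)
  qed
  have "exp (2 * t) * ?E t \<le> exp (2 * 0) * ?E 0"
  proof (rule DERIV_nonpos_imp_nonincreasing[OF t])
    fix s
    have "((\<lambda>s. exp (2 * s) * ?E s) has_real_derivative 2 * exp (2 * s) * (?E s - ?D s)) (at s)"
      by (rule derivative_eq_intros E_deriv refl)+ (simp add: algebra_simps)
    moreover have "?E s \<le> ?D s"
      using poisson_poincare[OF l mean[of s]] by simp
    then have "2 * exp (2 * s) * (?E s - ?D s) \<le> 0"
      by (intro mult_nonneg_nonpos) auto
    ultimately show "\<exists>y. ((\<lambda>s. exp (2 * s) * ?E s) has_real_derivative y) (at s) \<and> y \<le> 0"
      by blast
  qed
  then show ?thesis by simp
qed

section \<open>Duality and the cost of truncation\<close>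

text \<open>The forward rate is adjoint to the unreflected generator, so only the net flux through
  the edge above \<open>N\<close> survives; \<open>d 0 = 0\<close> removes the term at the
  bottom.\<close>

lemma forward_rate_dual:
  assumes "d 0 = 0"
  shows "(\<Sum>m\<le>N. forward_rate l d m * g m - d (Suc m) * truncated_generator l N g m) =
    (real (Suc N) * d (Suc (Suc N)) - l * d (Suc N)) * g N"
proof -
  have "(\<Sum>m<n. forward_rate l d m * g m
        - d (Suc m) * (l * (g (Suc m) - g m) - real m * (g m - g (m - 1)))) =
      real n * d (Suc n) * g (n - 1) - l * d n * g n" for n
    using assms by (induction n) (auto simp: forward_rate_def algebra_simps)
  note this[of N]
  moreover have "(\<Sum>m<N. forward_rate l d m * g m - d (Suc m) * truncated_generator l N g m) =
      (\<Sum>m<N. forward_rate l d m * g m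
        - d (Suc m) * (l * (g (Suc m) - g m) - real m * (g m - g (m - 1))))"
    by (intro sum.cong) (auto simp: truncated_generator_def min_def)
  ultimately show ?thesis
    by (simp add: lessThan_Suc_atMost[symmetric] truncated_generator_def forward_rate_def algebra_simps)
qed

text \<open>The pairing of \<open>d s\<close> with \<open>g (t - s)\<close> interpolates between the
  two sums; its derivative in \<open>s\<close> is the flux times \<open>g (t - s) N\<close>.\<close>

lemma truncation_error:
  fixes d g :: "real \<Rightarrow> nat \<Rightarrow> real"
  assumes t: "0 \<le> t"
    and d0: "\<And>s. s \<in> {0..t} \<Longrightarrow> d s 0 = 0"
    and d_deriv: "\<And>s m. s \<in> {0..t} \<Longrightarrow>
      ((\<lambda>s. d s (Suc m)) has_real_derivative forward_rate l (d s) m) (at s within {0..t})"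
    and g_deriv: "\<And>t m. ((\<lambda>s. g s m) has_real_derivative truncated_generator l N (g t) m) (at t)"
    and g_bound: "\<And>t m. 0 \<le> t \<Longrightarrow> \<bar>g t m\<bar> \<le> B"
    and flux: "\<And>s. s \<in> {0..t} \<Longrightarrow> \<bar>real (Suc N) * d s (Suc (Suc N)) - l * d s (Suc N)\<bar> \<le> r s"
    and r: "r integrable_on {0..t}"
  shows "\<bar>(\<Sum>m\<le>N. d t (Suc m) * g 0 m) - (\<Sum>m\<le>N. d 0 (Suc m) * g t m)\<bar> \<le> B * integral {0..t} r"
proof -
  let ?P = "\<lambda>s. \<Sum>m\<le>N. d s (Suc m) * g (t - s) m"
  let ?J = "\<lambda>s. (real (Suc N) * d s (Suc (Suc N)) - l * d s (Suc N)) * g (t - s) N"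
  have P_deriv: "(?P has_vector_derivative ?J s) (at s within {0..t})" if s: "s \<in> {0..t}" for s
  proof -
    have g': "((\<lambda>s. g (t - s) m) has_real_derivative - truncated_generator l N (g (t - s)) m)
        (at s within {0..t})" for m
    proof -
      have "((\<lambda>s. t - s) has_real_derivative - 1) (at s within {0..t})"
        by (auto intro!: derivative_eq_intros)
      from DERIV_chain2[where f = "\<lambda>s. g s m", OF g_deriv this] show ?thesis by simp
    qed
    have "(?P has_real_derivative (\<Sum>m\<le>N. forward_rate l (d s) m * g (t - s) m
        - d s (Suc m) * truncated_generator l N (g (t - s)) m)) (at s within {0..t})"
      by (auto intro!: derivative_eq_intros d_deriv[OF s] g' sum.cong simp: mult_ac)
    then show ?thesis
      unfolding forward_rate_dual[of "d s", OF d0[OF s]]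
      by (simp add: has_real_derivative_iff_has_vector_derivative)
  qed
  have J: "(?J has_integral (?P t - ?P 0)) {0..t}"
    using t P_deriv by (rule fundamental_theorem_of_calculus)
  have "norm (integral {0..t} ?J) \<le> integral {0..t} (\<lambda>s. r s * B)"
  proof (rule integral_norm_bound_integral)
    show "?J integrable_on {0..t}" using J by blast
    show "(\<lambda>s. r s * B) integrable_on {0..t}" using r by (rule integrable_on_mult_left)
    show "norm (?J s) \<le> r s * B" if "s \<in> {0..t}" for s
      unfolding real_norm_def abs_mult using flux[OF that] g_bound[of "t - s" N] that
      by (intro mult_mono) auto
  qed
  then show ?thesis
    using integral_unique[OF J] by (simp add: mult.commute)
qed

text \<open>Nonnegativity of \<open>x\<close> makes its derivative nonpositive, so \<open>x\<close>
  cannot rise above 0.\<close>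

lemma no_empty_state:
  assumes "0 \<le> l"
    and deriv: "\<And>t. 0 \<le> t \<Longrightarrow> (x has_real_derivative - (l + x t) * x t) (at t within {0..})"
    and nonneg: "\<And>t. 0 \<le> t \<Longrightarrow> 0 \<le> x t" and "x 0 = 0" and t: "0 \<le> t"
  shows "x t = (0::real)"
proof (cases "t = 0")
  case False
  with t have "0 < t" by simp
  have "(x has_derivative (*) (- (l + x s) * x s)) (at s within {0..t})" if "s \<in> {0..t}" for s
    using DERIV_subset[OF deriv[of s], of "{0..t}"] that
    by (auto simp: has_field_derivative_def)
  from mvt_simple[OF \<open>0 < t\<close> this] obtain s where s: "s \<in> {0<..<t}"
    and "x t - x 0 = - (l + x s) * x s * (t - 0)" by auto
  moreover have "(l + x s) * x s * t \<ge> 0"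
    using nonneg[of s] s assms(1) by simp
  ultimately show ?thesis using nonneg[OF t] \<open>x 0 = 0\<close>
    by (metis add.inverse_inverse diff_zero mult_minus_left neg_0_le_iff_le order_antisym_conv)
qed (simp add: \<open>x 0 = 0\<close>)


section \<open>Contraction in the weighted norm\<close>

text \<open>Only finite sums appear at time \<open>t\<close>, so finiteness of the norm there is not
  presupposed. The error depends on \<open>N\<close>, which tends to infinity with \<open>M\<close>
  fixed.\<close>

lemma weighted_contraction:
  fixes d r :: "_ \<Rightarrow> _ \<Rightarrow> real"
  assumes l: "0 < l" and t: "0 \<le> t"
    and d0: "\<And>s. s \<in> {0..t} \<Longrightarrow> d s 0 = 0"
    and d_deriv: "\<And>s m. s \<in> {0..t} \<Longrightarrow>
      ((\<lambda>s. d s (Suc m)) has_real_derivative forward_rate l (d s) m) (at s within {0..t})"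
    and flux: "\<And>s N. s \<in> {0..t} \<Longrightarrow>
      \<bar>real (Suc N) * d s (Suc (Suc N)) - l * d s (Suc N)\<bar> \<le> r N s"
    and r: "\<And>N. r N integrable_on {0..t}"
    and r_lim: "(\<lambda>N. integral {0..t} (r N)) \<longlonglongrightarrow> 0"
    and total: "(\<lambda>m. d 0 (Suc m)) sums 0"
    and summable: "summable (\<lambda>m. (d 0 (Suc m))\<^sup>2 / poisson_weight l m)"
  shows "(\<Sum>m\<le>M. (d t (Suc m))\<^sup>2 / poisson_weight l m)
    \<le> exp (- 2 * t) * (\<Sum>m. (d 0 (Suc m))\<^sup>2 / poisson_weight l m)"
proof -
  let ?w = "poisson_weight l"
  let ?X = "\<Sum>m\<le>M. (d t (Suc m))\<^sup>2 / ?w m"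
  let ?Q = "\<Sum>m. (d 0 (Suc m))\<^sup>2 / ?w m"
  have w: "0 < ?w m" for m by (rule poisson_weight_pos[OF l])
  \<comment> \<open>For this test function both the pairing with \<open>d t\<close> and the weighted
    energy equal \<open>?X\<close>, and its sup bound \<open>B\<close> does not depend on
    \<open>N\<close>.\<close>
  define f where "f m = (if m \<le> M then d t (Suc m) / ?w m else 0)" for m
  define B where "B = (\<Sum>m\<le>M. \<bar>f m\<bar>)"
  have f_bound: "\<bar>f m\<bar> \<le> B" for m
  proof (cases "m \<le> M")
    case True
    then show ?thesis unfolding B_def by (intro member_le_sum) auto
  qed (simp add: f_def B_def sum_nonneg)
  have key: "?X \<le> exp (- 2 * t) * ?Q
      + 2 * (B * \<bar>\<Sum>m\<le>N. d 0 (Suc m)\<bar> + B * integral {0..t} (r N))" if N: "M \<le> N" for N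
  proof -
    obtain g where g0: "g 0 = f"
      and g_deriv: "\<And>t m. ((\<lambda>s. g s m) has_real_derivative truncated_generator l N (g t) m) (at t)"
      and g_bound: "\<And>t m. 0 \<le> t \<Longrightarrow> \<bar>g t m\<bar> \<le> B"
      using truncated_generator_semigroup[of l f B N] l f_bound by auto
    define Z where "Z = (\<Sum>m\<le>N. ?w m)"
    \<comment> \<open>Mean of \<open>f\<close> under the weights renormalised up to
      \<open>N\<close>. Subtracting it allows decay; putting it back costs \<open>c\<close> times a
      partial sum of \<open>d 0\<close>, which tends to 0 by \<open>total\<close>.\<close>
    define c where "c = (\<Sum>m\<le>N. ?w m * f m) / Z"
    have Z: "0 < Z" unfolding Z_def using w by (intro sum_pos) auto
    have cZ: "(\<Sum>m\<le>N. ?w m * f m) = c * Z" using Z by (simp add: c_def)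
    have mean: "(\<Sum>m\<le>N. ?w m * (f m - c)) = 0"
      using cZ by (simp add: algebra_simps sum_subtractf sum_distrib_left Z_def)
    have c_bound: "\<bar>c\<bar> \<le> B"
    proof -
      have "\<bar>c\<bar> * Z = \<bar>\<Sum>m\<le>N. ?w m * f m\<bar>" using cZ Z by (simp add: abs_mult)
      also have "\<dots> \<le> (\<Sum>m\<le>N. ?w m * B)"
        using w f_bound by (intro order_trans[OF sum_abs] sum_mono)
          (simp add: abs_mult less_imp_le mult_left_mono)
      also have "\<dots> = B * Z" by (simp add: Z_def sum_distrib_left mult.commute)
      finally show ?thesis using Z by simp
    qed
    have restrict: "(\<Sum>m\<le>N. (if m \<le> M then x m else 0)) = (\<Sum>m\<le>M. x m)" for x :: "nat \<Rightarrow> real"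
      using N by (intro sum.mono_neutral_cong_right) auto
    have X_pair: "(\<Sum>m\<le>N. d t (Suc m) * f m) = ?X"
      unfolding restrict[symmetric] by (intro sum.cong) (auto simp: f_def power2_eq_square)
    have X_energy: "(\<Sum>m\<le>N. ?w m * (f m)\<^sup>2) = ?X"
      unfolding restrict[symmetric] using w
      by (intro sum.cong) (auto simp: f_def power2_eq_square less_imp_neq[symmetric])
    have "(\<Sum>m\<le>N. ?w m * (f m - c)\<^sup>2)
        = (\<Sum>m\<le>N. ?w m * (f m)\<^sup>2) - 2 * c * (\<Sum>m\<le>N. ?w m * (f m - c)) - c\<^sup>2 * Z"
      by (simp add: Z_def sum_distrib_left sum_subtractf[symmetric] power2_eq_square algebra_simps)
    then have "(\<Sum>m\<le>N. ?w m * (f m - c)\<^sup>2) \<le> ?X"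
      using mean X_energy Z by simp
    with truncated_semigroup_decay[OF l g_deriv _ t, of c] mean
    have decay: "exp (2 * t) * (\<Sum>m\<le>N. ?w m * (g t m - c)\<^sup>2) \<le> ?X"
      by (simp add: g0)
    \<comment> \<open>The exponential factors are chosen so that \<open>decay\<close> bounds the
      second part, once summed, by exactly \<open>?X\<close>.\<close>
    have young: "2 * (x * h) \<le> exp (- 2 * t) * (x\<^sup>2 / ?w m) + exp (2 * t) * (?w m * h\<^sup>2)" for x h m
    proof -
      have "0 \<le> exp (- 2 * t) / ?w m * (x - exp (2 * t) * ?w m * h)\<^sup>2"
        using w[of m] by simp
      also have "\<dots> = exp (- 2 * t) * (x\<^sup>2 / ?w m) + exp (2 * t) * (?w m * h\<^sup>2) - 2 * (x * h)"
        using w[of m] by (simp add: power2_eq_square exp_minus field_simps)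
      finally show ?thesis by simp
    qed
    have "2 * (\<Sum>m\<le>N. d 0 (Suc m) * (g t m - c))
        \<le> exp (- 2 * t) * (\<Sum>m\<le>N. (d 0 (Suc m))\<^sup>2 / ?w m)
          + exp (2 * t) * (\<Sum>m\<le>N. ?w m * (g t m - c)\<^sup>2)"
      unfolding sum_distrib_left sum.distrib[symmetric] by (intro sum_mono young)
    also have "\<dots> \<le> exp (- 2 * t) * ?Q + ?X"
      using summable w decay
      by (intro add_mono mult_left_mono sum_le_suminf) (auto intro: less_imp_le divide_nonneg_pos)
    finally have main: "2 * (\<Sum>m\<le>N. d 0 (Suc m) * (g t m - c)) \<le> exp (- 2 * t) * ?Q + ?X" .
    have 1: "(\<Sum>m\<le>N. d 0 (Suc m) * g t m)
        = (\<Sum>m\<le>N. d 0 (Suc m) * (g t m - c)) + c * (\<Sum>m\<le>N. d 0 (Suc m))"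
      by (simp add: sum_distrib_left sum.distrib[symmetric] algebra_simps)
    have 2: "c * (\<Sum>m\<le>N. d 0 (Suc m)) \<le> B * \<bar>\<Sum>m\<le>N. d 0 (Suc m)\<bar>"
      by (rule order_trans[OF abs_ge_self]) (simp add: abs_mult mult_right_mono c_bound)
    have 3: "\<bar>?X - (\<Sum>m\<le>N. d 0 (Suc m) * g t m)\<bar> \<le> B * integral {0..t} (r N)"
      using truncation_error[of t d l g N B "r N", OF t d0 d_deriv g_deriv g_bound flux r]
      by (simp add: g0 X_pair)
    \<comment> \<open>Here \<open>2 * X\<close> is at most \<open>X\<close> plus the rest, and one
      copy of \<open>X\<close> is absorbed.\<close>
    have "X \<le> e + 2 * (b + i)"
      if "S = A + k" "k \<le> b" "X - S \<le> i" "2 * A \<le> e + X" for X S A k b i e :: real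
      using that by (simp add: algebra_simps)
    from this[OF 1 2 abs_le_D1[OF 3] main] show ?thesis .
  qed
  have "(\<lambda>N. \<Sum>m\<le>N. d 0 (Suc m)) \<longlonglongrightarrow> 0"
    using total by (simp add: sums_def_le)
  then have "(\<lambda>N. exp (- 2 * t) * ?Q
      + 2 * (B * \<bar>\<Sum>m\<le>N. d 0 (Suc m)\<bar> + B * integral {0..t} (r N)))
    \<longlonglongrightarrow> exp (- 2 * t) * ?Q + 2 * (B * \<bar>0\<bar> + B * 0)"
    by (intro tendsto_add tendsto_mult tendsto_const tendsto_rabs r_lim)
  then have "?X \<le> exp (- 2 * t) * ?Q + 2 * (B * \<bar>0\<bar> + B * 0)"
    by (rule LIMSEQ_le_const) (intro exI allI impI key)
  then show ?thesis by (simp only: abs_zero mult_zero_right add_0_right)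
qed

section \<open>Vanishing of the flux at infinity\<close>

text \<open>At each time the sum over \<open>N\<close> is at most \<open>\<mu> + l\<close>: the mean
  controls the first term and the total mass the second. Integrating in time gives a summable
  sequence.\<close>

lemma flux_integral_tendsto_0:
  fixes p :: "real \<Rightarrow> nat \<Rightarrow> real"
  assumes l: "0 \<le> l" and t: "0 \<le> t"
    and p: "\<And>s. s \<in> {0..t} \<Longrightarrow> p s \<in> prob_mean \<mu>"
    and cont: "\<And>n. continuous_on {0..t} (\<lambda>s. p s n)"
  shows "(\<lambda>N. integral {0..t} (\<lambda>s. real (Suc N) * p s (Suc (Suc N)) + l * p s (Suc N))) \<longlonglongrightarrow> 0"
proof -
  let ?r = "\<lambda>N s. real (Suc N) * p s (Suc (Suc N)) + l * p s (Suc N)"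
  have r_int: "?r N integrable_on {0..t}" for N
    by (intro integrable_continuous_interval continuous_intros cont)
  have r_nonneg: "0 \<le> ?r N s" if "s \<in> {0..t}" for N s
    using p[OF that] l by (simp add: prob_mean_def)
  have "(\<Sum>N<M. integral {0..t} (?r N)) \<le> (\<mu> + l) * t" for M
  proof -
    have "(\<Sum>N<M. ?r N s) \<le> \<mu> + l" if s: "s \<in> {0..t}" for s
    proof -
      have nonneg: "0 \<le> p s n" for n using p[OF s] by (simp add: prob_mean_def)
      have mean: "(\<lambda>n. real n * p s n) sums \<mu>" and one: "p s sums 1"
        using p[OF s] by (simp_all add: prob_mean_def)
      have "(\<Sum>N<M. real (Suc N) * p s (Suc (Suc N))) \<le> (\<Sum>N<M. real (Suc (Suc N)) * p s (Suc (Suc N)))"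
        by (intro sum_mono mult_right_mono nonneg) simp
      also have "\<dots> = sum (\<lambda>n. real n * p s n) ((\<lambda>N. Suc (Suc N)) ` {..<M})"
        by (subst sum.reindex) (auto simp: inj_on_def)
      also have "\<dots> \<le> (\<Sum>n. real n * p s n)"
        using mean nonneg by (intro sum_le_suminf) (auto simp: sums_iff)
      finally have 1: "(\<Sum>N<M. real (Suc N) * p s (Suc (Suc N))) \<le> \<mu>"
        using mean by (simp add: sums_iff)
      have "(\<Sum>N<M. p s (Suc N)) = sum (p s) (Suc ` {..<M})"
        by (subst sum.reindex) (auto simp: inj_on_def)
      also have "\<dots> \<le> suminf (p s)"
        using one nonneg by (intro sum_le_suminf) (auto simp: sums_iff)
      finally have "l * (\<Sum>N<M. p s (Suc N)) \<le> l * 1"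
        using one l by (intro mult_left_mono) (auto simp: sums_iff)
      with 1 show ?thesis by (simp only: sum.distrib sum_distrib_left mult_1_right)
    qed
    then have "integral {0..t} (\<lambda>s. \<Sum>N<M. ?r N s) \<le> integral {0..t} (\<lambda>s. \<mu> + l)"
      using r_int by (intro integral_le integrable_sum) auto
    moreover have "integral {0..t} (\<lambda>s. \<Sum>N<M. ?r N s) = (\<Sum>N<M. integral {0..t} (?r N))"
      using r_int by (intro integral_sum) auto
    ultimately show ?thesis using t by (simp add: mult.commute)
  qed
  moreover have "0 \<le> integral {0..t} (?r N)" for N
    using r_nonneg by (intro integral_nonneg r_int) auto
  ultimately have "summable (\<lambda>N. integral {0..t} (?r N))"
    by (intro summableI_nonneg_bounded)
  then show ?thesis by (rule summable_LIMSEQ_zero)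
qed

section \<open>From the weighted contraction to the norm of the Hilbert space\<close>

theorem theorem4:
  fixes \<mu> :: real and p :: "real \<Rightarrow> nat \<Rightarrow> real"
  assumes "1 < \<mu>"
    and "solves_system \<mu> p"
    and "p 0 \<in> prob_mean \<mu>"
    and "\<forall>t\<ge>0. p t \<in> prob_mean \<mu>"
    and "p 0 0 = 0"
  shows "\<forall>t\<ge>0. (H_norm \<mu> (\<lambda>n. p t n - modified_poisson \<mu> n))\<^sup>2
           \<le> (H_norm \<mu> (\<lambda>n. p 0 n - modified_poisson \<mu> n))\<^sup>2 * ennreal (exp (- 2 * t))"
proof (intro allI impI)
  fix t :: real
  assume t: "0 \<le> t"
  define l where "l = \<mu> - 1"
  let ?w = "poisson_weight l"
  define d where "d s n = p s n - modified_poisson \<mu> n" for s n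
  have l: "0 < l" using assms(1) by (simp add: l_def)
  have w: "0 < ?w m" for m by (rule poisson_weight_pos[OF l])
  have mp_0: "modified_poisson \<mu> 0 = 0" and mp_Suc: "modified_poisson \<mu> (Suc m) = ?w m" for m
    by (simp_all add: modified_poisson_def poisson_weight_def l_def)
  have p_nonneg: "0 \<le> p s n" if "0 \<le> s" for s n
    using assms(4) that by (simp add: prob_mean_def)
  have p_0: "p s 0 = 0" if "0 \<le> s" for s
    using no_empty_state[of l "\<lambda>s. p s 0" s] assms(2,5) l p_nonneg that
    by (simp add: solves_system_def l_def)
  have d_0: "d s 0 = 0" if "0 \<le> s" for s
    using p_0[OF that] by (simp add: d_def mp_0)
  \<comment> \<open>Equilibrium by detailed balance, so that \<open>d\<close> obeys the same linear
    equation as \<open>p\<close>.\<close>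
  have stationary: "forward_rate l (modified_poisson \<mu>) m = 0" for m
  proof (cases m)
    case 0
    then show ?thesis using poisson_weight_Suc[of 0 l] by (simp add: forward_rate_def mp_0 mp_Suc)
  next
    case (Suc k)
    then show ?thesis using poisson_weight_Suc[of m l] poisson_weight_Suc[of k l]
      by (simp add: forward_rate_def mp_Suc)
  qed
  have p_deriv: "((\<lambda>s. p s (Suc m)) has_real_derivative forward_rate l (p s) m) (at s within {0..})"
    if "0 \<le> s" for s m
  proof -
    have "((\<lambda>s. p s (Suc m)) has_real_derivative
        real (Suc m) * p s (Suc m + 1) + (\<mu> - 1 + p s 0) * p s (Suc m - 1)
        - (real (Suc m) - 1) * p s (Suc m) - (\<mu> - 1 + p s 0) * p s (Suc m)) (at s within {0..})"
      by (rule assms(2)[unfolded solves_system_def, THEN spec, THEN mp, OF that,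
          THEN conjunct2, THEN spec, THEN mp]) simp
    then show ?thesis by (simp add: p_0[OF that] forward_rate_def l_def)
  qed
  have d_deriv: "((\<lambda>s. d s (Suc m)) has_real_derivative forward_rate l (d s) m) (at s within {0..t})"
    if "s \<in> {0..t}" for s m
  proof -
    have "((\<lambda>s. d s (Suc m)) has_real_derivative forward_rate l (p s) m) (at s within {0..t})"
      unfolding d_def using that
      by (auto intro!: derivative_eq_intros DERIV_subset[OF p_deriv])
    moreover have "forward_rate l (p s) m = forward_rate l (d s) m"
      using stationary[of m] by (simp add: d_def forward_rate_def algebra_simps)
    ultimately show ?thesis by simp
  qed
  let ?r = "\<lambda>N s. real (Suc N) * p s (Suc (Suc N)) + l * p s (Suc N)"
  have cont: "continuous_on {0..t} (\<lambda>s. p s n)" for n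
  proof (cases n)
    case 0
    have "continuous_on {0..t} (\<lambda>s. p s 0) \<longleftrightarrow> continuous_on {0..t} (\<lambda>s. 0 :: real)"
      using p_0 by (intro continuous_on_cong) auto
    then show ?thesis using 0 by simp
  next
    case (Suc m)
    have "continuous_on {0..t} (\<lambda>s. p s (Suc m))"
      by (rule DERIV_continuous_on[OF DERIV_subset[OF p_deriv]]) auto
    then show ?thesis using Suc by simp
  qed
  \<comment> \<open>The equilibrium has no net flux, which leaves that of \<open>p\<close>, a
    difference of nonnegative terms.\<close>
  have flux: "\<bar>real (Suc N) * d s (Suc (Suc N)) - l * d s (Suc N)\<bar> \<le> ?r N s"
    if "s \<in> {0..t}" for N s
  proof -
    have "real (Suc N) * d s (Suc (Suc N)) - l * d s (Suc N) =
        real (Suc N) * p s (Suc (Suc N)) - l * p s (Suc N)"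
      using poisson_weight_Suc[of N l] by (simp add: d_def mp_Suc algebra_simps)
    moreover have "0 \<le> real (Suc N) * p s (Suc (Suc N))" "0 \<le> l * p s (Suc N)"
      using that l p_nonneg by simp_all
    ultimately show ?thesis by linarith
  qed
  have total: "(\<lambda>m. d 0 (Suc m)) sums 0"
  proof -
    have "(\<lambda>m. p 0 (Suc m)) sums 1"
      using assms(3,5) by (subst sums_Suc_iff) (simp add: prob_mean_def)
    from sums_diff[OF this poisson_weight_sums[of l]] show ?thesis by (simp add: d_def mp_Suc)
  qed
  show "(H_norm \<mu> (\<lambda>n. p t n - modified_poisson \<mu> n))\<^sup>2
           \<le> (H_norm \<mu> (\<lambda>n. p 0 n - modified_poisson \<mu> n))\<^sup>2 * ennreal (exp (- 2 * t))"
    unfolding d_def[symmetric]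
  proof (cases "d 0 \<in> H_space \<mu>")
    \<comment> \<open>The exponential is positive, so the right-hand side stays infinite.\<close>
    case False
    then have "(H_norm \<mu> (d 0))\<^sup>2 * ennreal (exp (- 2 * t)) = \<infinity>"
      by (simp add: H_norm_def ennreal_top_mult power2_eq_square)
    then show "(H_norm \<mu> (d t))\<^sup>2 \<le> (H_norm \<mu> (d 0))\<^sup>2 * ennreal (exp (- 2 * t))" by simp
  next
    case True
    let ?q = "\<lambda>s m. (d s (Suc m))\<^sup>2 / ?w m"
    have q_nonneg: "0 \<le> ?q s m" for s m using w[of m] by simp
    have summable_0: "summable (?q 0)" using True by (simp add: H_space_def mp_Suc)
    have bound: "(\<Sum>m\<le>M. ?q t m) \<le> exp (- 2 * t) * suminf (?q 0)" for M
      using l t d_0 d_deriv flux total summable_0 assms(4) cont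
      by (intro weighted_contraction[where r = ?r] flux_integral_tendsto_0
          integrable_continuous_interval continuous_intros) auto
    then have bound': "(\<Sum>m<M. ?q t m) \<le> exp (- 2 * t) * suminf (?q 0)" for M
      using sum_mono2[of "{..M}" "{..<M}" "?q t"] q_nonneg order_trans by fastforce
    then have summable_t: "summable (?q t)"
      using q_nonneg by (intro summableI_nonneg_bounded)
    \<comment> \<open>\<open>H_space\<close> also asks for unweighted square summability, which
      follows from weights at most 1.\<close>
    have "summable (\<lambda>m. (d t (Suc m))\<^sup>2)"
    proof (rule summable_comparison_test'[OF summable_t])
      show "norm ((d t (Suc m))\<^sup>2) \<le> ?q t m" for m
        using mult_left_mono[OF poisson_weight_le_1[OF l, of m], of "(d t (Suc m))\<^sup>2"] w[of m]
        by (simp add: pos_le_divide_eq)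
    qed
    then have "summable (\<lambda>n. (d t n)\<^sup>2)" by (subst (asm) summable_Suc_iff)
    with summable_t have t_mem: "d t \<in> H_space \<mu>" by (simp add: H_space_def mp_Suc)
    have norm_eq: "(H_norm \<mu> (d s))\<^sup>2 = ennreal (suminf (?q s))"
      if "0 \<le> s" "d s \<in> H_space \<mu>" "summable (?q s)" for s
    proof -
      have "0 \<le> suminf (?q s)" using that(3) q_nonneg by (intro suminf_nonneg)
      then show ?thesis
        using that(2) d_0[OF that(1)]
        by (simp add: H_norm_def H_inner_def mp_Suc power2_eq_square[symmetric] ennreal_power)
    qed
    have "suminf (?q t) \<le> suminf (?q 0) * exp (- 2 * t)"
      using suminf_le_const[OF summable_t bound'] by (simp add: mult.commute)
    then show "(H_norm \<mu> (d t))\<^sup>2 \<le> (H_norm \<mu> (d 0))\<^sup>2 * ennreal (exp (- 2 * t))"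
      using norm_eq[OF t t_mem summable_t] norm_eq[OF _ True summable_0]
        suminf_nonneg[OF summable_0 q_nonneg]
      by (simp add: ennreal_mult[symmetric])
  qed
qed

end
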